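(* Let $R$ be a ring with unity in which the product of any two maximal right ideals is an almost prime right ideal, but not an idempotent ideal. Then $R$ is a local ring.
   Context: Rings are associative and not necessarily commutative. For right ideals $A,B$, $AB$ is the additive subgroup generated by all products $ab$ with $a\in A$, $b\in B$, and $P^2=PP$. A proper right ideal $P$ of $R$ is an almost prime right ideal if for all right ideals $A,B$ of $R$, $AB\subseteq P$ and $AB\not\subseteq P^2$ imply $A\subseteq P$ or $B\subseteq P$. A right ideal $I$ is idempotent if $I^2=I$. A ring with unity is local if it has a unique maximal right ideal. *)

theory Defs
  imports "HOL-Algebra.Algebra"
begin

text \<open>
  Rings are those of HOL-Algebra: associative, with unity, not necessarily commutative.
  The library only has two-sided ideals; the locales below are their right-handed counterparts.
\<close>

locale right_ideal = additive_subgroup I R + ring R for I and R (structure) +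
  assumes I_r_closed: "\<lbrakk>a \<in> I; x \<in> carrier R\<rbrakk> \<Longrightarrow> a \<otimes> x \<in> I"

locale maximal_right_ideal = right_ideal +
  assumes I_notcarr: "carrier R \<noteq> I"
    and I_maximal: "\<lbrakk>right_ideal J R; I \<subseteq> J; J \<subseteq> carrier R\<rbrakk> \<Longrightarrow> J = I \<or> J = carrier R"

text \<open>
  In the next definition \<open>A <#>\<^bsub>R\<^esub> B\<close> is only the set of products \<open>a \<otimes> b\<close>, and
  \<open>generate (add_monoid R)\<close> forms the generated additive subgroup. The library's
  \<^const>\<open>ideal_prod\<close> is not used: it closes the products under addition only.
\<close>

definition right_ideal_prod :: "('a, 'b) ring_scheme \<Rightarrow> 'a set \<Rightarrow> 'a set \<Rightarrow> 'a set"
  where "right_ideal_prod R A B = generate (add_monoid R) (A <#>\<^bsub>R\<^esub> B)"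

locale almost_prime_right_ideal = right_ideal P R for P and R (structure) +
  assumes P_notcarr: "carrier R \<noteq> P"
    and P_almost_prime:
      "\<lbrakk>right_ideal A R; right_ideal B R; right_ideal_prod R A B \<subseteq> P;
        \<not> right_ideal_prod R A B \<subseteq> right_ideal_prod R P P\<rbrakk> \<Longrightarrow> A \<subseteq> P \<or> B \<subseteq> P"

locale idempotent_right_ideal = right_ideal I R for I and R (structure) +
  assumes I_idem: "right_ideal_prod R I I = I"

definition local_ring :: "('a, 'b) ring_scheme \<Rightarrow> bool"
  where "local_ring R \<longleftrightarrow> ring R \<and> (\<exists>!M. maximal_right_ideal M R)"

end

theory Submission
  imports Defs
begin

text \<open>
  Let \<open>M \<noteq> N\<close> be maximal right ideals and \<open>P = MN\<close>. Since \<open>P\<close> is not idempotent,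
  \<open>MN = P \<not>\<subseteq> P\<^sup>2\<close>, so almost primeness, applied to the factors \<open>M\<close> and \<open>N\<close> of \<open>P\<close> itself,
  puts \<open>M\<close> or \<open>N\<close> inside \<open>MN \<subseteq> M\<close>. The inclusion \<open>N \<subseteq> M\<close> would contradict maximality of \<open>N\<close>,
  hence \<open>MN = M\<close>; by symmetry \<open>NM = N\<close>. These two absorption laws force
  \<open>M\<^sup>2 = (MN)M = M(NM) = MN = M\<close>, so \<open>MN = M\<close> is idempotent after all.
  Thus there is at most one maximal right ideal, and Zorn's lemma supplies one because
  \<open>\<one> \<noteq> \<zero>\<close>.
\<close>

lemma (in ring) right_ideal_prod_contains:
  "\<lbrakk>a \<in> A; b \<in> B\<rbrakk> \<Longrightarrow> a \<otimes> b \<in> right_ideal_prod R A B"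
  unfolding right_ideal_prod_def set_mult_def by (blast intro: generate.incl)

lemma (in ring) right_ideal_prod_least:
  assumes "additive_subgroup H R"
    and "\<And>a b. \<lbrakk>a \<in> A; b \<in> B\<rbrakk> \<Longrightarrow> a \<otimes> b \<in> H"
  shows "right_ideal_prod R A B \<subseteq> H"
  unfolding right_ideal_prod_def
  by (rule group.generate_subgroup_incl[OF add.is_group])
    (use assms in \<open>auto simp: set_mult_def additive_subgroup_def\<close>)

lemma (in ring) right_ideal_prod_additive_subgroup:
  assumes "A \<subseteq> carrier R" "B \<subseteq> carrier R"
  shows "additive_subgroup (right_ideal_prod R A B) R"
proof -
  have "A <#> B \<subseteq> carrier R"
    using assms by (auto simp: set_mult_def)
  then show ?thesis
    unfolding right_ideal_prod_def
    by (intro additive_subgroup.intro) (simp add: add.generate_is_subgroup)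
qed

lemma (in ring) right_ideal_prod_subset_left:
  assumes "right_ideal A R" "B \<subseteq> carrier R"
  shows "right_ideal_prod R A B \<subseteq> A"
proof -
  interpret right_ideal A R by fact
  show ?thesis
    using assms(2) I_r_closed by (intro right_ideal_prod_least is_additive_subgroup) auto
qed

text \<open>
  Being sent into an additive subgroup by a fixed multiplication is an additive condition, so to
  check it on a product of ideals it suffices to check it on the generators. This is how
  associativity passes from elements to ideals.
\<close>

lemma (in ring) additive_subgroup_preimage_mult_right:
  assumes "additive_subgroup H R" "c \<in> carrier R"
  shows "additive_subgroup {x \<in> carrier R. x \<otimes> c \<in> H} R"
proof -
  interpret H: additive_subgroup H R by fact
  show ?thesis
    by (intro additive_subgroup.intro add.subgroupI)
      (use assms(2) in \<open>auto simp: l_distr l_minus intro: exI[of _ \<zero>]\<close>)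
qed

lemma (in ring) additive_subgroup_preimage_mult_left:
  assumes "additive_subgroup H R" "c \<in> carrier R"
  shows "additive_subgroup {x \<in> carrier R. c \<otimes> x \<in> H} R"
proof -
  interpret H: additive_subgroup H R by fact
  show ?thesis
    by (intro additive_subgroup.intro add.subgroupI)
      (use assms(2) in \<open>auto simp: r_distr r_minus intro: exI[of _ \<zero>]\<close>)
qed

lemma (in ring) right_ideal_prod_assoc:
  assumes A: "A \<subseteq> carrier R" and B: "B \<subseteq> carrier R" and C: "C \<subseteq> carrier R"
  shows "right_ideal_prod R (right_ideal_prod R A B) C =
         right_ideal_prod R A (right_ideal_prod R B C)"
    (is "?L = ?R")
proof
  note AB = right_ideal_prod_additive_subgroup[OF A B]
  note BC = right_ideal_prod_additive_subgroup[OF B C]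
  have L: "additive_subgroup ?L R"
    by (intro right_ideal_prod_additive_subgroup additive_subgroup.a_subset AB C)
  have R: "additive_subgroup ?R R"
    by (intro right_ideal_prod_additive_subgroup additive_subgroup.a_subset BC A)
  show "?L \<subseteq> ?R"
  proof (rule right_ideal_prod_least[OF R])
    fix x c assume x: "x \<in> right_ideal_prod R A B" and c: "c \<in> C"
    have "right_ideal_prod R A B \<subseteq> {x \<in> carrier R. x \<otimes> c \<in> ?R}"
    proof (rule right_ideal_prod_least)
      show "additive_subgroup {x \<in> carrier R. x \<otimes> c \<in> ?R} R"
        using additive_subgroup_preimage_mult_right[OF R] c C by blast
      fix a b assume ab: "a \<in> A" "b \<in> B"
      have "a \<otimes> (b \<otimes> c) \<in> ?R"
        using ab c by (intro right_ideal_prod_contains)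
      moreover have "a \<in> carrier R" "b \<in> carrier R" "c \<in> carrier R"
        using ab c A B C by auto
      ultimately show "a \<otimes> b \<in> {x \<in> carrier R. x \<otimes> c \<in> ?R}"
        by (simp add: m_assoc)
    qed
    then show "x \<otimes> c \<in> ?R" using x by blast
  qed
  show "?R \<subseteq> ?L"
  proof (rule right_ideal_prod_least[OF L])
    fix a x assume a: "a \<in> A" and x: "x \<in> right_ideal_prod R B C"
    have "right_ideal_prod R B C \<subseteq> {x \<in> carrier R. a \<otimes> x \<in> ?L}"
    proof (rule right_ideal_prod_least)
      show "additive_subgroup {x \<in> carrier R. a \<otimes> x \<in> ?L} R"
        using additive_subgroup_preimage_mult_left[OF L] a A by blast
      fix b c assume bc: "b \<in> B" "c \<in> C"
      have "a \<otimes> b \<otimes> c \<in> ?L"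
        using a bc by (intro right_ideal_prod_contains)
      moreover have "a \<in> carrier R" "b \<in> carrier R" "c \<in> carrier R"
        using a bc A B C by auto
      ultimately show "b \<otimes> c \<in> {x \<in> carrier R. a \<otimes> x \<in> ?L}"
        by (simp add: m_assoc)
    qed
    then show "a \<otimes> x \<in> ?L" using x by blast
  qed
qed

lemma (in ring) right_ideal_eq_carrier_iff:
  assumes "right_ideal I R"
  shows "I = carrier R \<longleftrightarrow> \<one> \<in> I"
proof -
  interpret right_ideal I R by fact
  show ?thesis
    using I_r_closed[of \<one>] a_subset by force
qed

lemma (in ring) right_ideal_Union_chain:
  assumes "subset.chain {I. right_ideal I R} \<C>" "\<C> \<noteq> {}"
  shows "right_ideal (\<Union>\<C>) R"
proof -
  have ri: "right_ideal I R" if "I \<in> \<C>" for I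
    using assms(1) that by (auto simp: subset.chain_def)
  note sub = right_ideal.axioms(1)[OF ri]
  have "additive_subgroup (\<Union>\<C>) R"
  proof (intro additive_subgroup.intro add.subgroupI)
    show "\<Union>\<C> \<subseteq> carrier R"
      using additive_subgroup.a_subset[OF sub] by blast
    show "\<Union>\<C> \<noteq> {}"
      using assms(2) additive_subgroup.zero_closed[OF sub] by blast
    show "\<ominus> a \<in> \<Union>\<C>" if "a \<in> \<Union>\<C>" for a
      using that additive_subgroup.a_inv_closed[OF sub] by blast
    show "a \<oplus> b \<in> \<Union>\<C>" if "a \<in> \<Union>\<C>" "b \<in> \<Union>\<C>" for a b
    proof -
      from that obtain I J where IJ: "I \<in> \<C>" "J \<in> \<C>" "a \<in> I" "b \<in> J" by blast
      moreover from IJ assms(1) have "I \<subseteq> J \<or> J \<subseteq> I"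
        by (auto simp: subset_chain_def)
      ultimately show ?thesis
        using additive_subgroup.a_closed[OF sub] by blast
    qed
  qed
  moreover have "a \<otimes> x \<in> \<Union>\<C>" if "a \<in> \<Union>\<C>" "x \<in> carrier R" for a x
    using that right_ideal.I_r_closed[OF ri] by blast
  ultimately show ?thesis
    by (intro right_ideal.intro right_ideal_axioms.intro ring_axioms)
qed

text \<open>
  Properness of a right ideal means missing \<open>\<one>\<close>, a condition that survives unions of chains.
\<close>

lemma (in ring) maximal_right_ideal_exists:
  assumes "\<one> \<noteq> \<zero>"
  shows "\<exists>M. maximal_right_ideal M R"
proof -
  let ?S = "{I. right_ideal I R \<and> \<one> \<notin> I}"
  have "right_ideal {\<zero>} R"
    by (intro right_ideal.intro right_ideal_axioms.intro ring_axioms ideal.axioms(1) zeroideal) auto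
  then have "{\<zero>} \<in> ?S"
    using assms by simp
  moreover have "\<Union>\<C> \<in> ?S" if "\<C> \<noteq> {}" "subset.chain ?S \<C>" for \<C>
  proof -
    have "subset.chain {I. right_ideal I R} \<C>"
      using that(2) by (auto simp: subset_chain_def)
    then show ?thesis
      using that right_ideal_Union_chain by (auto simp: subset_chain_def)
  qed
  ultimately obtain M where M: "M \<in> ?S" and max: "\<And>J. \<lbrakk>J \<in> ?S; M \<subseteq> J\<rbrakk> \<Longrightarrow> J = M"
    using subset_Zorn_nonempty[of ?S] by blast
  have "maximal_right_ideal M R"
  proof (intro maximal_right_ideal.intro maximal_right_ideal_axioms.intro)
    show "right_ideal M R" "carrier R \<noteq> M"
      using M by auto
    show "J = M \<or> J = carrier R" if "right_ideal J R" "M \<subseteq> J" for J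
      using that max[of J] right_ideal_eq_carrier_iff[of J] by blast
  qed
  then show ?thesis ..
qed

text \<open>
  A non-idempotent product \<open>P\<close> of right ideals is not contained in \<open>P\<^sup>2\<close>, so being almost prime
  gives the same information about its two factors as being prime would.
\<close>

lemma (in ring) almost_prime_non_idempotent_prod:
  assumes "right_ideal A R" "right_ideal B R"
    and ap: "almost_prime_right_ideal (right_ideal_prod R A B) R"
    and ni: "\<not> idempotent_right_ideal (right_ideal_prod R A B) R"
  shows "A \<subseteq> right_ideal_prod R A B \<or> B \<subseteq> right_ideal_prod R A B"
proof -
  let ?P = "right_ideal_prod R A B"
  interpret P: almost_prime_right_ideal ?P R by fact
  have "right_ideal_prod R ?P ?P \<noteq> ?P"
    using ni P.right_ideal_axioms
    by (auto simp: idempotent_right_ideal_def idempotent_right_ideal_axioms_def)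
  moreover have "right_ideal_prod R ?P ?P \<subseteq> ?P"
    by (intro right_ideal_prod_subset_left P.right_ideal_axioms P.a_subset)
  ultimately show ?thesis
    using P.P_almost_prime[OF assms(1,2)] by blast
qed

lemma (in ring) maximal_right_ideal_prod_eq_left:
  assumes "maximal_right_ideal M R" "maximal_right_ideal N R" "M \<noteq> N"
    and "almost_prime_right_ideal (right_ideal_prod R M N) R"
    and "\<not> idempotent_right_ideal (right_ideal_prod R M N) R"
  shows "right_ideal_prod R M N = M"
proof -
  interpret M: maximal_right_ideal M R by fact
  interpret N: maximal_right_ideal N R by fact
  have sub: "right_ideal_prod R M N \<subseteq> M"
    by (intro right_ideal_prod_subset_left M.right_ideal_axioms N.a_subset)
  have "\<not> N \<subseteq> M"
    using N.I_maximal[OF M.right_ideal_axioms] M.a_subset M.I_notcarr assms(3) by blast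
  then show ?thesis
    using sub almost_prime_non_idempotent_prod[OF M.right_ideal_axioms N.right_ideal_axioms]
      assms(4,5) by blast
qed

theorem theorem2p14:
  fixes R (structure)
  assumes "ring R"
    and "\<one> \<noteq> \<zero>"
    and "\<And>M N. \<lbrakk>maximal_right_ideal M R; maximal_right_ideal N R; M \<noteq> N\<rbrakk> \<Longrightarrow>
           almost_prime_right_ideal (right_ideal_prod R M N) R \<and>
           \<not> idempotent_right_ideal (right_ideal_prod R M N) R"
  shows "local_ring R"
proof -
  interpret ring R by fact
  have "M = N" if M: "maximal_right_ideal M R" and N: "maximal_right_ideal N R" for M N
  proof (rule ccontr)
    assume "M \<noteq> N"
    interpret M: maximal_right_ideal M R by fact
    interpret N: maximal_right_ideal N R by fact
    have MN: "right_ideal_prod R M N = M" and NM: "right_ideal_prod R N M = N"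
      using maximal_right_ideal_prod_eq_left assms(3) M N \<open>M \<noteq> N\<close> by metis+
    have "right_ideal_prod R M M = M"
      using right_ideal_prod_assoc[OF M.a_subset N.a_subset M.a_subset] by (simp add: MN NM)
    then have "idempotent_right_ideal M R"
      by (intro idempotent_right_ideal.intro idempotent_right_ideal_axioms.intro
          M.right_ideal_axioms)
    then show False
      using assms(3)[OF M N \<open>M \<noteq> N\<close>] by (simp add: MN)
  qed
  then show ?thesis
    using maximal_right_ideal_exists[OF assms(2)] ring_axioms unfolding local_ring_def by blast
qed

end
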